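(* Let $F=\frac1n\sum_{i=1}^n f_i:\mathbb{R}^d\to\mathbb{R}$, and suppose that: (1) $F$ is twice continuously differentiable; (2) the gradient of $F$ is $\Lambda$-Lipschitz continuous on $\mathbb{R}^d$, and for every (nonempty) set $O\subset\{1,\ldots,n\}$ the gradient of $F^{O}$ is $\Lambda_O$-Lipschitz continuous on $\mathbb{R}^d$; (3) $F$ is bounded below by a scalar $\widehat F$; (4) there exist constants $\gamma\ge0$ and $\eta>0$ such that $\mathbb{E}_{S}\big[\|\nabla F^{S}(w)\|^2\big]\le\gamma^2+\eta\|\nabla F(w)\|^2$ for all $w\in\mathbb{R}^d$ and all sample sets $S\subset\{1,\ldots,n\}$; (5) the samples $S$ are drawn independently and $\nabla F^{S}(w)$ is an unbiased estimator of $\nabla F(w)$ for all $w\in\mathbb{R}^d$, i.e. $\mathbb{E}_S[\nabla F^{S}(w)]=\nabla F(w)$. Let $\epsilon>0$ be given. Let $\{w_k\}$ be the iterates generated, starting from $w_0$, by the multi-batch L-BFGS method with the modification that $H_{k+1}=H_k$ whenever the newly computed correction pair $(s,y)$ does not satisfy $y^Ts\ge\epsilon\|s\|^2$; let $0<\mu_1\le\mu_2$ be constants such that the generated inverse Hessian approximations satisfy $\mu_1I\preceq H_k\preceq\mu_2I$ for all $k\ge 0$, and let the step length be constant, $\alpha_k=\alpha\in\left(0,\frac{\mu_1}{\mu_2^2\eta\Lambda}\right)$. Then for every integer $L\ge1$, $$\mathbb{E}\left[\frac1L\sum_{k=0}^{L-1}\|\nabla F(w_k)\|^2\right]\le\frac{\alpha\mu_2^2\gamma^2\Lambda}{\mu_1}+\frac{2[F(w_0)-\widehat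 F]}{\alpha\mu_1L},$$ and the right-hand side converges to $\frac{\alpha\mu_2^2\gamma^2\Lambda}{\mu_1}$ as $L\to\infty$.
   Context: For nonempty $A\subset\{1,\ldots,n\}$ write $F^{A}(w)=\frac1{|A|}\sum_{i\in A}f_i(w)$ and $g_k^{A}=\nabla F^{A}(w_k)$. $X\preceq Y$ means $Y-X$ is symmetric positive semidefinite. $\mathbb{E}_S$ is expectation over the random draw of the batch $S$; $\mathbb{E}$ is the total expectation over all batches and all history starting from $w_0$. Multi-batch L-BFGS method with cautious (skipping) updates. Inputs: initial iterate $w_0\in\mathbb{R}^d$, memory parameter $m\ge1$, and $\epsilon>0$. At iteration $k=0,1,2,\ldots$ a random batch $S_k\subset\{1,\ldots,n\}$ is used and $$w_{k+1}=w_k-\alpha_kH_kg_k^{S_k}.$$ The next batch $S_{k+1}$ is then created, and with a nonempty overlap set $O_k$ (either $O_k=S_k\cap S_{k+1}$, or $O_k$ formed by randomly selecting elements of $S_k$) one computes the correction pair $$s_{k+1}=w_{k+1}-w_k,\qquad y_{k+1}=g_{k+1}^{O_k}-g_k^{O_k},\qquad g_{k+1}^{O_k}=\nabla F^{O_k}(w_{k+1}).$$ If $y_{k+1}^Ts_{k+1}<\epsilon\|s_{k+1}\|^2$ (or $s_{k+1}=0$), the pair is not stored and $H_{k+1}=H_k$. Otherwise the pair is stored and, if more than $m$ pairs are stored, the oldest one is discarded; then $H_{k+1}$ is the matrix obtained by starting from $\frac{s^Ty}{y^Ty}I$, where $(s,y)$ is the most recently stored pair, and applying successively, for all stored pairs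 $(s_j,y_j)$ from oldest to newest, the BFGS update $$H\leftarrow V_j^THV_j+\rho_js_js_j^T,\qquad \rho_j=\frac1{y_j^Ts_j},\qquad V_j=I-\rho_jy_js_j^T.$$ $H_0$ is a fixed positive multiple of the identity. Under hypotheses (1)-(2), constants $0<\mu_1\le\mu_2$ with $\mu_1I\preceq H_k\preceq\mu_2I$ for all $k$ exist; $\mu_1,\mu_2$ in the claim are such constants.
   Formalization: Each batch S_k is assumed independent of all earlier batches and overlap sets, not only of earlier batches; this generally excludes O_k = S_k ∩ S_{k+1}, for which the claim fails in general because H_k is then correlated with S_k. *)

theory Defs
  imports "HOL-Probability.Probability"
begin

definition gradient :: "('a::real_inner \<Rightarrow> real) \<Rightarrow> 'a \<Rightarrow> 'a" where
  "gradient f x = (THE D. GDERIV f x :> D)"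

(* Differentiability is part of the definition because gradient is only meaningful
   where f is differentiable. *)
definition lipschitz_gradient :: "real \<Rightarrow> ('a::real_inner \<Rightarrow> real) \<Rightarrow> bool" where
  "lipschitz_gradient C f \<longleftrightarrow>
     (\<forall>x. f differentiable (at x)) \<and> C-lipschitz_on UNIV (gradient f)"

definition twice_continuously_differentiable :: "(real^'d \<Rightarrow> real) \<Rightarrow> bool" where
  "twice_continuously_differentiable f \<longleftrightarrow>
     (\<forall>x. f differentiable (at x)) \<and>
     (\<exists>Hess :: real^'d \<Rightarrow> real^'d^'d.
        (\<forall>x. (gradient f has_derivative (\<lambda>h. Hess x *v h)) (at x)) \<and>
        continuous_on UNIV Hess)"

definition pos_semidef :: "real^'d^'d \<Rightarrow> bool" where
  "pos_semidef A \<longleftrightarrow> transpose A = A \<and> (\<forall>x. 0 \<le> x \<bullet> (A *v x))"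

definition loewner_le :: "real^'d^'d \<Rightarrow> real^'d^'d \<Rightarrow> bool" (infix "\<preceq>" 50) where
  "X \<preceq> Y \<longleftrightarrow> pos_semidef (Y - X)"

definition outer :: "real^'d \<Rightarrow> real^'d \<Rightarrow> real^'d^'d" where
  "outer u v = (\<chi> i j. u $ i * v $ j)"

definition subset_avg :: "(nat \<Rightarrow> 'a \<Rightarrow> real) \<Rightarrow> nat set \<Rightarrow> 'a \<Rightarrow> real" where
  "subset_avg f A w = (\<Sum>i\<in>A. f i w) / real (card A)"

(* A correction pair is (s, y). *)
definition bfgs_update :: "real^'d^'d \<Rightarrow> (real^'d) \<times> (real^'d) \<Rightarrow> real^'d^'d" where
  "bfgs_update H p =
     (let s = fst p; y = snd p; \<rho> = 1 / (y \<bullet> s); V = mat 1 - \<rho> *\<^sub>R outer y s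
      in transpose V ** H ** V + \<rho> *\<^sub>R outer s s)"

(* Stored pairs are listed from oldest to newest; used on nonempty lists only. *)
definition lbfgs_matrix :: "((real^'d) \<times> (real^'d)) list \<Rightarrow> real^'d^'d" where
  "lbfgs_matrix ps =
     (let s = fst (last ps); y = snd (last ps)
      in foldl bfgs_update (mat ((s \<bullet> y) / (y \<bullet> y))) ps)"

definition store_pair :: "nat \<Rightarrow> 'p list \<Rightarrow> 'p \<Rightarrow> 'p list" where
  "store_pair m ps p = (let qs = ps @ [p] in if length qs > m then tl qs else qs)"

(* State of the method: current iterate, inverse Hessian approximation, stored pairs. *)
type_synonym 'd lbfgs_state =
  "(real^'d) \<times> (real^'d^'d) \<times> ((real^'d) \<times> (real^'d)) list"

(* One iteration with step length a, batch S and overlap set Q. *)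
definition lbfgs_step ::
  "nat \<Rightarrow> real \<Rightarrow> (nat \<Rightarrow> real^'d \<Rightarrow> real) \<Rightarrow> real \<Rightarrow> nat set \<Rightarrow> nat set
    \<Rightarrow> 'd lbfgs_state \<Rightarrow> 'd lbfgs_state" where
  "lbfgs_step m \<epsilon> f a S Q st =
     (case st of (w, H, ps) \<Rightarrow>
        let w' = w - a *\<^sub>R (H *v gradient (subset_avg f S) w);
            s = w' - w;
            y = gradient (subset_avg f Q) w' - gradient (subset_avg f Q) w
        in if y \<bullet> s < \<epsilon> * (norm s)\<^sup>2 \<or> s = 0 then (w', H, ps)
           else let ps' = store_pair m ps (s, y) in (w', lbfgs_matrix ps', ps'))"

(* \<alpha>, S, Q are the sequences of step lengths, batches and overlap sets;
   the initial inverse Hessian approximation is \<theta> I and no pairs are stored initially. *)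
primrec lbfgs_iterates ::
  "nat \<Rightarrow> real \<Rightarrow> (nat \<Rightarrow> real^'d \<Rightarrow> real) \<Rightarrow> (nat \<Rightarrow> real) \<Rightarrow> real^'d \<Rightarrow> real
    \<Rightarrow> (nat \<Rightarrow> nat set) \<Rightarrow> (nat \<Rightarrow> nat set) \<Rightarrow> nat \<Rightarrow> 'd lbfgs_state" where
  "lbfgs_iterates m \<epsilon> f \<alpha> w0 \<theta> S Q 0 = (w0, mat \<theta>, [])"
| "lbfgs_iterates m \<epsilon> f \<alpha> w0 \<theta> S Q (Suc k) =
     lbfgs_step m \<epsilon> f (\<alpha> k) (S k) (Q k) (lbfgs_iterates m \<epsilon> f \<alpha> w0 \<theta> S Q k)"

definition lbfgs_w ::
  "nat \<Rightarrow> real \<Rightarrow> (nat \<Rightarrow> real^'d \<Rightarrow> real) \<Rightarrow> (nat \<Rightarrow> real) \<Rightarrow> real^'d \<Rightarrow> real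
    \<Rightarrow> (nat \<Rightarrow> nat set) \<Rightarrow> (nat \<Rightarrow> nat set) \<Rightarrow> nat \<Rightarrow> real^'d" where
  "lbfgs_w m \<epsilon> f \<alpha> w0 \<theta> S Q k = fst (lbfgs_iterates m \<epsilon> f \<alpha> w0 \<theta> S Q k)"

definition lbfgs_H ::
  "nat \<Rightarrow> real \<Rightarrow> (nat \<Rightarrow> real^'d \<Rightarrow> real) \<Rightarrow> (nat \<Rightarrow> real) \<Rightarrow> real^'d \<Rightarrow> real
    \<Rightarrow> (nat \<Rightarrow> nat set) \<Rightarrow> (nat \<Rightarrow> nat set) \<Rightarrow> nat \<Rightarrow> real^'d^'d" where
  "lbfgs_H m \<epsilon> f \<alpha> w0 \<theta> S Q k = fst (snd (lbfgs_iterates m \<epsilon> f \<alpha> w0 \<theta> S Q k))"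

(* Independent sampling: each batch S k is independent of all random choices that enter
   iterations 0, ..., k - 1, hence of those determining the k-th iterate and the k-th inverse
   Hessian approximation.  Mutual independence of the S k alone does not give the latter: an
   overlap set such as Q (k - 1) = S (k - 1) \<inter> S k would correlate the k-th approximation
   with S k.  The constant indep_set requires its arguments to
   consist of events, so measurability of all S k and Q k is included. *)
definition independent_sampling ::
  "'w measure \<Rightarrow> (nat \<Rightarrow> 'w \<Rightarrow> nat set) \<Rightarrow> (nat \<Rightarrow> 'w \<Rightarrow> nat set) \<Rightarrow> bool" where
  "independent_sampling M S Q \<longleftrightarrow>
     (\<forall>k. prob_space.indep_set M
            (sets (vimage_algebra (space M) (S k) (count_space UNIV)))
            (sets (vimage_algebra (space M) (\<lambda>\<omega>. map (\<lambda>j. (S j \<omega>, Q j \<omega>)) [0..<k])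
              (count_space UNIV))))"

end

theory Submission
  imports Defs
begin

text \<open>
  The batch \<open>S k\<close> is independent of the history of batches and overlap sets, which takes finitely
  many values and determines \<open>w k\<close> and \<open>H k\<close>. Freezing the history and averaging the
  descent inequality for functions with Lipschitz gradient over \<open>S k\<close> gives
  \<open>E F (w (k+1)) \<le> E F (w k) - \<alpha> (\<mu>1 - \<alpha> \<mu>2\<^sup>2 \<eta> \<Lambda> / 2) E |\<nabla>F (w k)|\<^sup>2 + \<alpha>\<^sup>2 \<mu>2\<^sup>2 \<gamma>\<^sup>2 \<Lambda> / 2\<close>;
  the step length bound makes the bracket at least \<open>\<mu>1 / 2\<close>, and the sum over \<open>k\<close> telescopes.
\<close>

section \<open>Gradients and the quadratic upper bound\<close>

lemma GDERIV_gradient: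
  fixes f :: "'a::euclidean_space \<Rightarrow> real"
  assumes "f differentiable (at x)"
  shows "GDERIV f x :> gradient f x"
proof -
  from assms obtain D where D: "(f has_derivative D) (at x)"
    by (auto simp: differentiable_def)
  have lin: "linear D"
    using D has_derivative_linear by blast
  \<comment> \<open>The Riesz representative of the derivative \<open>D\<close>; existence and
    uniqueness of such a vector are what the definite description in \<open>gradient\<close>
    requires.\<close>
  define g where "g = (\<Sum>b\<in>Basis. D b *\<^sub>R b)"
  have "D h = h \<bullet> g" for h
  proof -
    have "D h = D (\<Sum>b\<in>Basis. (h \<bullet> b) *\<^sub>R b)"
      by (simp add: euclidean_representation)
    also have "\<dots> = (\<Sum>b\<in>Basis. (h \<bullet> b) * D b)"
      using lin by (simp add: linear_sum linear_cmul)
    also have "\<dots> = h \<bullet> g"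
      by (simp add: g_def inner_sum_right mult.commute)
    finally show ?thesis .
  qed
  then have g: "GDERIV f x :> g"
    using D unfolding gderiv_def by presburger
  moreover have "g' = g" if "GDERIV f x :> g'" for g'
  proof -
    have "(\<lambda>h. h \<bullet> g') = (\<lambda>h. h \<bullet> g)"
      using g that unfolding gderiv_def by (rule has_derivative_unique[rotated])
    then show ?thesis
      by (metis inner_commute vector_eq_rdot)
  qed
  ultimately show ?thesis
    unfolding gradient_def by (rule theI)
qed

text \<open>The descent lemma, obtained from monotonicity instead of integration: along the segment,
  \<open>F\<close> minus the linear and quadratic terms of the bound is nonincreasing for
  \<open>t \<ge> 0\<close>, and comparing \<open>t = 1\<close> with \<open>t = 0\<close> gives the
  claim.\<close>

lemma lipschitz_gradient_upper_bound:
  fixes F :: "'a::euclidean_space \<Rightarrow> real"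
  assumes "lipschitz_gradient C F"
  shows "F (x + p) \<le> F x + p \<bullet> gradient F x + C / 2 * (norm p)\<^sup>2"
proof -
  define \<psi> where "\<psi> t = F (x + t *\<^sub>R p) - t * (p \<bullet> gradient F x) - C / 2 * (norm p)\<^sup>2 * t\<^sup>2" for t
  have F': "(F has_derivative (\<lambda>h. h \<bullet> gradient F z)) (at z)" for z
    using assms GDERIV_gradient by (auto simp: lipschitz_gradient_def gderiv_def)
  have "(\<psi> has_real_derivative
      p \<bullet> (gradient F (x + t *\<^sub>R p) - gradient F x) - C * (norm p)\<^sup>2 * t) (at t)" for t
  proof -
    have "((\<lambda>t. F (x + t *\<^sub>R p)) has_derivative
        (\<lambda>h. (h *\<^sub>R p) \<bullet> gradient F (x + t *\<^sub>R p))) (at t)"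
      by (rule has_derivative_compose[OF _ F']) (auto intro!: derivative_eq_intros)
    then have "((\<lambda>t. F (x + t *\<^sub>R p)) has_real_derivative p \<bullet> gradient F (x + t *\<^sub>R p)) (at t)"
      by (simp add: has_field_derivative_def mult_commute_abs)
    then show ?thesis
      unfolding \<psi>_def by (auto intro!: derivative_eq_intros simp: inner_diff_right)
  qed
  moreover have "p \<bullet> (gradient F (x + t *\<^sub>R p) - gradient F x) - C * (norm p)\<^sup>2 * t \<le> 0"
    if "0 \<le> t" for t
  proof -
    have "norm (gradient F (x + t *\<^sub>R p) - gradient F x) \<le> C * (t * norm p)"
      using assms that lipschitz_onD[of C UNIV "gradient F" "x + t *\<^sub>R p" x]
      by (auto simp: lipschitz_gradient_def dist_norm)
    then have "norm p * norm (gradient F (x + t *\<^sub>R p) - gradient F x) \<le> norm p * (C * (t * norm p))"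
      by (rule mult_left_mono) simp
    moreover have "p \<bullet> (gradient F (x + t *\<^sub>R p) - gradient F x)
        \<le> norm p * norm (gradient F (x + t *\<^sub>R p) - gradient F x)"
      by (rule norm_cauchy_schwarz)
    ultimately show ?thesis
      by (simp add: power2_eq_square algebra_simps)
  qed
  ultimately have "\<exists>y. DERIV \<psi> t :> y \<and> y \<le> 0" if "0 \<le> t" for t
    using that by blast
  then have "\<psi> 1 \<le> \<psi> 0"
    using DERIV_nonpos_imp_nonincreasing[of 0 1 \<psi>] zero_le_one by blast
  then show ?thesis
    by (simp add: \<psi>_def algebra_simps)
qed

section \<open>Quadratic forms and the Loewner order\<close>

lemma mat_mult_vector: "mat c *v x = c *\<^sub>R x"
  for x :: "real^'n"
  by (simp add: vec_eq_iff matrix_vector_mult_def mat_def if_distrib if_distribR sum.delta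
      cong: if_cong)

lemma pos_semidef_sym: "pos_semidef A \<Longrightarrow> x \<bullet> (A *v y) = y \<bullet> (A *v x)"
  by (metis dot_lmul_matrix inner_commute pos_semidef_def transpose_matrix_vector)

lemma pos_semidef_mat: "0 \<le> c \<Longrightarrow> pos_semidef (mat c)"
  by (simp add: pos_semidef_def mat_mult_vector)

lemma pos_semidef_add: "pos_semidef A \<Longrightarrow> pos_semidef B \<Longrightarrow> pos_semidef (A + B)"
  by (auto simp: pos_semidef_def matrix_vector_mult_add_rdistrib inner_add_right transpose_def
      vec_eq_iff)

text \<open>Write \<open>A\<close> as the sum of \<open>A - mat c\<close> and \<open>mat c\<close>.
  Besides nonnegativity this yields the symmetry of \<open>A\<close>, which later moves the inverse
  Hessian approximation across an inner product.\<close>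

lemma mat_loewner_le_pos_semidef: "0 \<le> c \<Longrightarrow> mat c \<preceq> A \<Longrightarrow> pos_semidef A"
  using pos_semidef_add[OF pos_semidef_mat, of c "A - mat c"] by (simp add: loewner_le_def)

lemma mat_loewner_le_inner: "mat c \<preceq> A \<Longrightarrow> c * (norm x)\<^sup>2 \<le> x \<bullet> (A *v x)"
  by (simp add: loewner_le_def pos_semidef_def matrix_vector_mult_diff_rdistrib inner_diff_right
      mat_mult_vector power2_norm_eq_inner)

lemma loewner_le_mat_inner: "A \<preceq> mat c \<Longrightarrow> x \<bullet> (A *v x) \<le> c * (norm x)\<^sup>2"
  by (simp add: loewner_le_def pos_semidef_def matrix_vector_mult_diff_rdistrib inner_diff_right
      mat_mult_vector power2_norm_eq_inner)

lemma pos_semidef_norm_le: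
  assumes A: "pos_semidef A" and le: "A \<preceq> mat c" and c: "0 < c"
  shows "norm (A *v x) \<le> c * norm x"
proof -
  define y where "y = A *v x"
  \<comment> \<open>The form at \<open>x - A x / c\<close> is nonnegative; this replaces Cauchy-Schwarz for the form.\<close>
  have "0 \<le> (x - (1 / c) *\<^sub>R y) \<bullet> (A *v (x - (1 / c) *\<^sub>R y))"
    using A by (simp add: pos_semidef_def)
  also have "A *v (x - (1 / c) *\<^sub>R y) = y - (1 / c) *\<^sub>R (A *v y)"
    by (simp add: y_def matrix_vector_mult_diff_distrib matrix_vector_mult_scaleR)
  also have "(x - (1 / c) *\<^sub>R y) \<bullet> (y - (1 / c) *\<^sub>R (A *v y))
      = x \<bullet> y - 1 / c * (x \<bullet> (A *v y)) - 1 / c * (y \<bullet> y) + 1 / c * (1 / c * (y \<bullet> (A *v y)))"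
    by (simp only: inner_diff_left inner_diff_right inner_scaleR_left inner_scaleR_right) argo
  also have "x \<bullet> (A *v y) = y \<bullet> y"
    using pos_semidef_sym[OF A, of x y] by (simp only: y_def)
  finally have "0 \<le> x \<bullet> y - 2 / c * (norm y)\<^sup>2 + 1 / c * (1 / c * (y \<bullet> (A *v y)))"
    by (simp add: power2_norm_eq_inner)
  moreover have "x \<bullet> y \<le> c * (norm x)\<^sup>2"
    unfolding y_def by (rule loewner_le_mat_inner[OF le])
  \<comment> \<open>The upper bound at \<open>y\<close> costs one of the two negative copies of
    \<open>(norm y)\<^sup>2 / c\<close>; the other copy survives and is bounded by
    \<open>x \<bullet> y\<close>.\<close>
  moreover have "1 / c * (1 / c * (y \<bullet> (A *v y))) \<le> 1 / c * (norm y)\<^sup>2"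
    using c loewner_le_mat_inner[OF le, of y]
    by (intro mult_left_mono) (simp_all add: pos_divide_le_eq mult.commute)
  ultimately have "(norm y)\<^sup>2 / c \<le> c * (norm x)\<^sup>2"
    by simp
  then have "(norm y)\<^sup>2 \<le> (c * norm x)\<^sup>2"
    using c by (simp add: pos_divide_le_eq power_mult_distrib power2_eq_square[of c] mult_ac)
  then show ?thesis
    unfolding y_def by (rule power2_le_imp_le) (use c in simp)
qed

section \<open>Finitely valued random variables and independence\<close>

context finite_measure
begin

text \<open>Any function of a simple function is again simple, hence integrable for a finite
  measure. This settles integrability of everything that depends on finitely many batches and
  overlap sets.\<close>

lemma simple_function_integrable:
  fixes \<phi> :: "'b \<Rightarrow> 'c::{banach, second_countable_topology}"
  assumes "simple_function M X"
  shows "integrable M (\<lambda>\<omega>. \<phi> (X \<omega>))"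
proof -
  have "simple_function M (\<lambda>\<omega>. \<phi> (X \<omega>))"
    using simple_function_compose[OF assms, of \<phi>] by (simp add: comp_def)
  then show ?thesis
    by (intro integrableI_simple_bochner_integrable
        Bochner_Integration.simple_bochner_integrable.intros)
      (simp_all add: emeasure_eq_measure)
qed

text \<open>Values outside the range have an empty level set and contribute zero. Allowing a
  superset \<open>A\<close> of the range lets a pair of variables be summed over the product of
  their ranges, although not every pair need occur.\<close>

lemma integral_simple_function:
  fixes \<phi> :: "'b \<Rightarrow> real"
  assumes X: "simple_function M X" and A: "finite A" "X ` space M \<subseteq> A"
  shows "(\<integral>\<omega>. \<phi> (X \<omega>) \<partial>M) = (\<Sum>x\<in>A. \<phi> x * measure M (X -` {x} \<inter> space M))"
proof -
  have ev: "X -` {x} \<inter> space M \<in> sets M" for x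
    by (rule simple_functionD(2)[OF X])
  have "(\<integral>\<omega>. \<phi> (X \<omega>) \<partial>M) = (\<integral>\<omega>. (\<Sum>x\<in>A. \<phi> x * indicator (X -` {x} \<inter> space M) \<omega>) \<partial>M)"
  proof (rule Bochner_Integration.integral_cong[OF refl])
    fix \<omega> assume \<omega>: "\<omega> \<in> space M"
    then have "(\<Sum>x\<in>A. \<phi> x * indicator (X -` {x} \<inter> space M) \<omega>)
        = (\<Sum>x\<in>A. if X \<omega> = x then \<phi> x else 0)"
      by (intro sum.cong) (auto simp: indicator_def)
    also have "\<dots> = \<phi> (X \<omega>)"
      using \<omega> A by (subst sum.delta') auto
    finally show "\<phi> (X \<omega>) = (\<Sum>x\<in>A. \<phi> x * indicator (X -` {x} \<inter> space M) \<omega>)" ..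
  qed
  also have "\<dots> = (\<Sum>x\<in>A. \<integral>\<omega>. \<phi> x * indicator (X -` {x} \<inter> space M) \<omega> \<partial>M)"
    using ev by (intro Bochner_Integration.integral_sum integrable_mult_right
        integrable_real_indicator) (auto simp: less_top[symmetric])
  also have "\<dots> = (\<Sum>x\<in>A. \<phi> x * measure M (X -` {x} \<inter> space M))"
    using ev by (intro sum.cong) auto
  finally show ?thesis .
qed

end

lemma vimage_algebra_singleton:
  "X -` {x} \<inter> \<Omega> \<in> sets (vimage_algebra \<Omega> X (count_space UNIV))"
  by (rule in_vimage_algebra) simp

text \<open>Independence already contains measurability: \<open>indep_set\<close> forces the
  generated sets, in particular the level sets of \<open>X\<close>, to be events.\<close>

lemma (in prob_space) indep_set_simple_function:
  assumes "indep_set (sets (vimage_algebra (space M) X (count_space UNIV))) B"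
    and "finite (X ` space M)"
  shows "simple_function M X"
  unfolding simple_function_def
  using assms indep_setD_ev1[OF assms(1)] vimage_algebra_singleton[of X _ "space M"] by blast

lemma (in prob_space) indep_set_commute: "indep_set A B \<Longrightarrow> indep_set B A"
  unfolding indep_sets2_eq by (subst Int_commute, subst mult.commute) blast

text \<open>A finite form of conditioning on \<open>Y\<close>: the joint law factors over level
  sets, so the expectation is a weighted sum over \<open>y\<close> of integrals in which
  \<open>y\<close> is frozen. The premise concerns only attained values \<open>Y \<omega>'\<close>,
  because the matrix bounds are available only for histories that occur.\<close>

lemma (in prob_space) integral_indep_mono:
  fixes \<phi> :: "'b \<Rightarrow> 'c \<Rightarrow> real"
  assumes ind: "indep_set (sets (vimage_algebra (space M) X (count_space UNIV)))
                 (sets (vimage_algebra (space M) Y (count_space UNIV)))"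
    and fin: "finite (X ` space M)" "finite (Y ` space M)"
    and le: "\<And>\<omega>'. \<omega>' \<in> space M \<Longrightarrow> (\<integral>\<omega>. \<phi> (Y \<omega>') (X \<omega>) \<partial>M) \<le> \<psi> (Y \<omega>')"
  shows "(\<integral>\<omega>. \<phi> (Y \<omega>) (X \<omega>) \<partial>M) \<le> (\<integral>\<omega>. \<psi> (Y \<omega>) \<partial>M)"
proof -
  let ?A = "X ` space M" and ?B = "Y ` space M"
  have X: "simple_function M X"
    by (rule indep_set_simple_function[OF ind fin(1)])
  have Y: "simple_function M Y"
    by (rule indep_set_simple_function[OF indep_set_commute[OF ind] fin(2)])
  have XY: "simple_function M (\<lambda>\<omega>. (Y \<omega>, X \<omega>))"
    by (rule simple_function_Pair[OF Y X])
  have prod: "measure M ((\<lambda>\<omega>. (Y \<omega>, X \<omega>)) -` {(y, x)} \<inter> space M)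
      = measure M (Y -` {y} \<inter> space M) * measure M (X -` {x} \<inter> space M)" for x y
  proof -
    have "(\<lambda>\<omega>. (Y \<omega>, X \<omega>)) -` {(y, x)} \<inter> space M
        = (X -` {x} \<inter> space M) \<inter> (Y -` {y} \<inter> space M)"
      by auto
    then show ?thesis
      using indep_setD[OF ind vimage_algebra_singleton vimage_algebra_singleton, of x y]
      by (simp add: mult.commute)
  qed
  have "(\<integral>\<omega>. \<phi> (Y \<omega>) (X \<omega>) \<partial>M) = (\<integral>\<omega>. case_prod \<phi> (Y \<omega>, X \<omega>) \<partial>M)"
    by simp
  also have "\<dots> = (\<Sum>p\<in>?B \<times> ?A. case_prod \<phi> p * measure M ((\<lambda>\<omega>. (Y \<omega>, X \<omega>)) -` {p} \<inter> space M))"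
    using fin by (intro integral_simple_function[OF XY]) auto
  also have "\<dots> = (\<Sum>(y, x)\<in>?B \<times> ?A. measure M (Y -` {y} \<inter> space M)
      * (\<phi> y x * measure M (X -` {x} \<inter> space M)))"
    by (intro sum.cong) (auto simp: prod)
  also have "\<dots> = (\<Sum>y\<in>?B. measure M (Y -` {y} \<inter> space M)
      * (\<Sum>x\<in>?A. \<phi> y x * measure M (X -` {x} \<inter> space M)))"
    by (simp add: sum.cartesian_product[symmetric] sum_distrib_left)
  also have "\<dots> = (\<Sum>y\<in>?B. measure M (Y -` {y} \<inter> space M) * (\<integral>\<omega>. \<phi> y (X \<omega>) \<partial>M))"
    using fin by (subst integral_simple_function[OF X]) auto
  also have "\<dots> \<le> (\<Sum>y\<in>?B. measure M (Y -` {y} \<inter> space M) * \<psi> y)"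
    using le by (intro sum_mono mult_left_mono) auto
  also have "\<dots> = (\<integral>\<omega>. \<psi> (Y \<omega>) \<partial>M)"
    using fin by (subst integral_simple_function[OF Y]) (auto simp: mult.commute)
  finally show ?thesis .
qed

section \<open>The iterates and the expected decrease in one step\<close>

text \<open>Iteration \<open>j\<close> reads only \<open>S j\<close> and \<open>Q j\<close>. Hence
  the state before iteration \<open>k\<close> is a function of the history up to
  \<open>k - 1\<close>, the object from which batch \<open>k\<close> is independent.\<close>

lemma lbfgs_iterates_cong:
  assumes "\<And>j. j < k \<Longrightarrow> S j = S' j" "\<And>j. j < k \<Longrightarrow> Q j = Q' j"
  shows "lbfgs_iterates m \<epsilon> f \<alpha> w0 \<theta> S Q k = lbfgs_iterates m \<epsilon> f \<alpha> w0 \<theta> S' Q' k"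
  using assms by (induction k) auto

lemma lbfgs_w_Suc:
  "lbfgs_w m \<epsilon> f \<alpha> w0 \<theta> S Q (Suc k) =
     lbfgs_w m \<epsilon> f \<alpha> w0 \<theta> S Q k - \<alpha> k *\<^sub>R (lbfgs_H m \<epsilon> f \<alpha> w0 \<theta> S Q k *v
       gradient (subset_avg f (S k)) (lbfgs_w m \<epsilon> f \<alpha> w0 \<theta> S Q k))"
  by (simp add: lbfgs_w_def lbfgs_H_def lbfgs_step_def Let_def split: prod.split)

text \<open>The one-step estimate with the history frozen: \<open>x\<close> and \<open>H\<close> are
  constants, and the batch \<open>X\<close> is the only source of randomness.\<close>

lemma (in prob_space) expected_descent:
  fixes F :: "real^'d \<Rightarrow> real" and G :: "'b \<Rightarrow> real^'d"
  assumes X: "simple_function M X"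
    and lip: "lipschitz_gradient \<Lambda> F"
    and unbiased: "(\<integral>\<omega>. G (X \<omega>) \<partial>M) = gradient F x"
    and second_moment: "(\<integral>\<omega>. (norm (G (X \<omega>)))\<^sup>2 \<partial>M) \<le> \<gamma>\<^sup>2 + \<eta> * (norm (gradient F x))\<^sup>2"
    and H: "mat \<mu>1 \<preceq> H" "H \<preceq> mat \<mu>2" and mu: "0 < \<mu>1" "\<mu>1 \<le> \<mu>2"
    and \<alpha>: "0 < \<alpha>" "\<alpha> * (\<mu>2\<^sup>2 * \<eta> * \<Lambda>) \<le> \<mu>1"
  shows "(\<integral>\<omega>. F (x - \<alpha> *\<^sub>R (H *v G (X \<omega>))) \<partial>M)
    \<le> F x - \<alpha> * \<mu>1 / 2 * (norm (gradient F x))\<^sup>2 + \<alpha>\<^sup>2 * \<mu>2\<^sup>2 * \<gamma>\<^sup>2 * \<Lambda> / 2"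
proof -
  let ?g = "gradient F x"
  have \<Lambda>: "0 \<le> \<Lambda>"
    using lip by (auto simp: lipschitz_gradient_def intro: lipschitz_on_nonneg)
  have psd: "pos_semidef H"
    using mat_loewner_le_pos_semidef[OF _ H(1)] mu by simp
  \<comment> \<open>The coefficient of the squared norm of \<open>v\<close> in the quadratic upper
    bound, once \<open>norm (H *v v)\<close> is replaced by \<open>\<mu>2 * norm v\<close>.\<close>
  define c where "c = \<Lambda> / 2 * \<alpha>\<^sup>2 * \<mu>2\<^sup>2"
  have c: "0 \<le> c"
    using \<Lambda> by (simp add: c_def)
  have pointwise: "F (x - \<alpha> *\<^sub>R (H *v v)) \<le> F x - \<alpha> * ((H *v ?g) \<bullet> v) + c * (norm v)\<^sup>2" for v
  proof -
    have "norm (H *v v) \<le> \<mu>2 * norm v"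
      using mu by (intro pos_semidef_norm_le[OF psd H(2)]) simp
    then have "(norm (H *v v))\<^sup>2 \<le> \<mu>2\<^sup>2 * (norm v)\<^sup>2"
      using power_mono[of "norm (H *v v)" "\<mu>2 * norm v" 2] by (simp add: power_mult_distrib)
    then have "\<Lambda> / 2 * \<alpha>\<^sup>2 * (norm (H *v v))\<^sup>2 \<le> \<Lambda> / 2 * \<alpha>\<^sup>2 * (\<mu>2\<^sup>2 * (norm v)\<^sup>2)"
      using \<Lambda> by (intro mult_left_mono) auto
    \<comment> \<open>Symmetry puts \<open>H\<close> on the deterministic gradient, so the
      expectation of the linear term reduces to that of the batch gradient.\<close>
    moreover have "(H *v v) \<bullet> ?g = (H *v ?g) \<bullet> v"
      using pos_semidef_sym[OF psd, of ?g v] by (simp add: inner_commute)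
    ultimately show ?thesis
      using lipschitz_gradient_upper_bound[OF lip, of x "- \<alpha> *\<^sub>R (H *v v)"]
      by (simp add: c_def power_mult_distrib mult.assoc)
  qed
  have int: "integrable M (\<lambda>\<omega>. \<phi> (X \<omega>))" for \<phi> :: "'b \<Rightarrow> real"
    by (rule simple_function_integrable[OF X])
  have intG: "integrable M (\<lambda>\<omega>. G (X \<omega>))"
    by (rule simple_function_integrable[OF X])
  have int1: "integrable M (\<lambda>\<omega>. (H *v ?g) \<bullet> G (X \<omega>))"
    by (rule int)
  have int2: "integrable M (\<lambda>\<omega>. (norm (G (X \<omega>)))\<^sup>2)"
    by (rule int)
  have "(\<integral>\<omega>. F (x - \<alpha> *\<^sub>R (H *v G (X \<omega>))) \<partial>M)
      \<le> (\<integral>\<omega>. F x - \<alpha> * ((H *v ?g) \<bullet> G (X \<omega>)) + c * (norm (G (X \<omega>)))\<^sup>2 \<partial>M)"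
    by (intro integral_mono int pointwise)
  also have "\<dots> = F x - \<alpha> * ((H *v ?g) \<bullet> ?g) + c * (\<integral>\<omega>. (norm (G (X \<omega>)))\<^sup>2 \<partial>M)"
    using int1 int2 intG by (simp add: prob_space unbiased)
  also have "\<dots> \<le> F x - \<alpha> * (\<mu>1 * (norm ?g)\<^sup>2) + c * (\<gamma>\<^sup>2 + \<eta> * (norm ?g)\<^sup>2)"
    using \<alpha> c second_moment mat_loewner_le_inner[OF H(1), of ?g]
    by (intro add_mono diff_mono mult_left_mono) (auto simp: inner_commute)
  also have "\<dots> \<le> F x - \<alpha> * \<mu>1 / 2 * (norm ?g)\<^sup>2 + \<alpha>\<^sup>2 * \<mu>2\<^sup>2 * \<gamma>\<^sup>2 * \<Lambda> / 2"
  proof -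
    \<comment> \<open>The left side is \<open>c * \<eta> * (norm ?g)\<^sup>2\<close>. The step
      length bound makes it at most half of the decrease from the linear term, so the other half
      remains.\<close>
    have "(\<alpha> / 2 * (norm ?g)\<^sup>2) * (\<alpha> * (\<mu>2\<^sup>2 * \<eta> * \<Lambda>)) \<le> (\<alpha> / 2 * (norm ?g)\<^sup>2) * \<mu>1"
      using \<alpha> by (intro mult_left_mono) auto
    then show ?thesis
      by (simp add: c_def power2_eq_square algebra_simps)
  qed
  finally show ?thesis .
qed

section \<open>The bound on the averaged squared gradient norms\<close>

theorem theorem3p4:
  fixes n m :: nat
    and f :: "nat \<Rightarrow> real^'d \<Rightarrow> real"
    and F :: "real^'d \<Rightarrow> real"
    and \<Lambda> Fhat \<gamma> \<eta> \<epsilon> \<theta> \<mu>1 \<mu>2 \<alpha> :: real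
    and \<Lambda>O :: "nat set \<Rightarrow> real"
    and w0 :: "real^'d"
    and M :: "'w measure"
    and S Q :: "nat \<Rightarrow> 'w \<Rightarrow> nat set"
    and w :: "nat \<Rightarrow> 'w \<Rightarrow> real^'d"
    and H :: "nat \<Rightarrow> 'w \<Rightarrow> real^'d^'d"
  assumes n: "n \<ge> 1"
    and F: "\<And>x. F x = (\<Sum>i=1..n. f i x) / real n"
    and C2: "twice_continuously_differentiable F"
    and lip_F: "lipschitz_gradient \<Lambda> F"
    and lip_O: "\<And>A. A \<subseteq> {1..n} \<Longrightarrow> A \<noteq> {} \<Longrightarrow> lipschitz_gradient (\<Lambda>O A) (subset_avg f A)"
    and bounded_below: "\<And>x. Fhat \<le> F x"
    and prob: "prob_space M"
    and batch: "\<And>k \<omega>. \<omega> \<in> space M \<Longrightarrow> S k \<omega> \<subseteq> {1..n} \<and> S k \<omega> \<noteq> {}"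
    and overlap: "\<And>k \<omega>. \<omega> \<in> space M \<Longrightarrow> Q k \<omega> \<subseteq> S k \<omega> \<and> Q k \<omega> \<noteq> {}"
    and gamma: "\<gamma> \<ge> 0"
    and eta: "\<eta> > 0"
    and second_moment:
      "\<And>k x. (\<integral>\<omega>. (norm (gradient (subset_avg f (S k \<omega>)) x))\<^sup>2 \<partial>M)
                \<le> \<gamma>\<^sup>2 + \<eta> * (norm (gradient F x))\<^sup>2"
    and independent: "independent_sampling M S Q"
    and unbiased: "\<And>k x. (\<integral>\<omega>. gradient (subset_avg f (S k \<omega>)) x \<partial>M) = gradient F x"
    and eps: "\<epsilon> > 0"
    and m: "m \<ge> 1"
    and theta: "\<theta> > 0"
    and w: "\<And>k \<omega>. w k \<omega> = lbfgs_w m \<epsilon> f (\<lambda>_. \<alpha>) w0 \<theta> (\<lambda>j. S j \<omega>) (\<lambda>j. Q j \<omega>) k"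
    and H: "\<And>k \<omega>. H k \<omega> = lbfgs_H m \<epsilon> f (\<lambda>_. \<alpha>) w0 \<theta> (\<lambda>j. S j \<omega>) (\<lambda>j. Q j \<omega>) k"
    and mu: "0 < \<mu>1" "\<mu>1 \<le> \<mu>2"
    and H_bounds: "\<And>k \<omega>. \<omega> \<in> space M \<Longrightarrow> mat \<mu>1 \<preceq> H k \<omega> \<and> H k \<omega> \<preceq> mat \<mu>2"
    and alpha: "\<alpha> \<in> {0 <..< \<mu>1 / (\<mu>2\<^sup>2 * \<eta> * \<Lambda>)}"
  shows "(\<forall>L::nat. L \<ge> 1 \<longrightarrow>
            (\<integral>\<omega>. (1 / real L) * (\<Sum>k<L. (norm (gradient F (w k \<omega>)))\<^sup>2) \<partial>M)
              \<le> \<alpha> * \<mu>2\<^sup>2 * \<gamma>\<^sup>2 * \<Lambda> / \<mu>1 + 2 * (F w0 - Fhat) / (\<alpha> * \<mu>1 * real L))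
       \<and> ((\<lambda>L::nat. \<alpha> * \<mu>2\<^sup>2 * \<gamma>\<^sup>2 * \<Lambda> / \<mu>1 + 2 * (F w0 - Fhat) / (\<alpha> * \<mu>1 * real L))
            \<longlonglongrightarrow> \<alpha> * \<mu>2\<^sup>2 * \<gamma>\<^sup>2 * \<Lambda> / \<mu>1)"
proof -
  interpret prob_space M by (rule prob)
  define hist where "hist k \<omega> = map (\<lambda>j. (S j \<omega>, Q j \<omega>)) [0..<k]" for k \<omega>
  \<comment> \<open>\<open>W\<close> and \<open>HH\<close> are deterministic functions of a history
    list. Only entries with index below \<open>k\<close> are read, so for
    \<open>hist k \<omega>\<close> of length \<open>k\<close> no access is out of range.\<close>
  define W where "W k h = lbfgs_w m \<epsilon> f (\<lambda>_. \<alpha>) w0 \<theta> (\<lambda>j. fst (h ! j)) (\<lambda>j. snd (h ! j)) k"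
    for k and h :: "(nat set \<times> nat set) list"
  define HH where "HH k h = lbfgs_H m \<epsilon> f (\<lambda>_. \<alpha>) w0 \<theta> (\<lambda>j. fst (h ! j)) (\<lambda>j. snd (h ! j)) k"
    for k and h :: "(nat set \<times> nat set) list"
  have iter: "lbfgs_iterates m \<epsilon> f (\<lambda>_. \<alpha>) w0 \<theta> (\<lambda>j. S j \<omega>) (\<lambda>j. Q j \<omega>) k
      = lbfgs_iterates m \<epsilon> f (\<lambda>_. \<alpha>) w0 \<theta> (\<lambda>j. fst (hist k \<omega> ! j)) (\<lambda>j. snd (hist k \<omega> ! j)) k"
    for k \<omega>
    by (rule lbfgs_iterates_cong) (auto simp: hist_def)
  have wW: "w k \<omega> = W k (hist k \<omega>)" for k \<omega>
    unfolding w W_def lbfgs_w_def by (simp only: iter)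
  have HHH: "H k \<omega> = HH k (hist k \<omega>)" for k \<omega>
    unfolding H HH_def lbfgs_H_def by (simp only: iter)
  have ind: "indep_set (sets (vimage_algebra (space M) (S k) (count_space UNIV)))
      (sets (vimage_algebra (space M) (hist k) (count_space UNIV)))" for k
    using independent unfolding independent_sampling_def hist_def by blast
  have finS: "finite (S k ` space M)" for k
  proof (rule finite_subset)
    show "S k ` space M \<subseteq> Pow {1..n}"
      using batch by blast
  qed simp
  have finhist: "finite (hist k ` space M)" for k
  proof (rule finite_subset)
    show "hist k ` space M \<subseteq> {xs. set xs \<subseteq> Pow {1..n} \<times> Pow {1..n} \<and> length xs = k}"
    proof (rule image_subsetI)
      fix \<omega> assume "\<omega> \<in> space M"
      then have "S j \<omega> \<subseteq> {1..n}" "Q j \<omega> \<subseteq> {1..n}" for j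
        using batch[of \<omega> j] overlap[of \<omega> j] by blast+
      then show "hist k \<omega> \<in> {xs. set xs \<subseteq> Pow {1..n} \<times> Pow {1..n} \<and> length xs = k}"
        by (auto simp: hist_def)
    qed
    show "finite {xs. set xs \<subseteq> Pow {1..n} \<times> Pow {1..n} \<and> length xs = k}"
      by (rule finite_lists_length_eq) auto
  qed
  have Ssimple: "simple_function M (S k)" for k
    by (rule indep_set_simple_function[OF ind finS])
  have hsimple: "simple_function M (hist k)" for k
    by (rule indep_set_simple_function[OF indep_set_commute[OF ind] finhist])
  have int: "integrable M (\<lambda>\<omega>. \<phi> (w k \<omega>))" for k and \<phi> :: "real^'d \<Rightarrow> real"
    unfolding wW using simple_function_integrable[OF hsimple, of "\<lambda>h. \<phi> (W k h)"] .
  \<comment> \<open>If \<open>\<Lambda> = 0\<close>, the interval for \<open>\<alpha>\<close> is empty because \<open>\<mu>1 / 0 = 0\<close>.\<close>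
  have \<Lambda>: "0 < \<Lambda>"
  proof -
    have "0 \<le> \<Lambda>"
      using lip_F by (auto simp: lipschitz_gradient_def intro: lipschitz_on_nonneg)
    moreover have "\<Lambda> \<noteq> 0"
      using alpha by auto
    ultimately show ?thesis by simp
  qed
  have \<alpha>: "0 < \<alpha>" "\<alpha> * (\<mu>2\<^sup>2 * \<eta> * \<Lambda>) \<le> \<mu>1"
    using alpha mu eta \<Lambda> by (auto simp: field_simps)
  \<comment> \<open>The noise that one step adds to the expected objective.\<close>
  define D where "D = \<alpha>\<^sup>2 * \<mu>2\<^sup>2 * \<gamma>\<^sup>2 * \<Lambda> / 2"
  have step: "(\<integral>\<omega>. F (w (Suc k) \<omega>) \<partial>M)
      \<le> (\<integral>\<omega>. F (w k \<omega>) \<partial>M) - \<alpha> * \<mu>1 / 2 * (\<integral>\<omega>. (norm (gradient F (w k \<omega>)))\<^sup>2 \<partial>M) + D" for k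
  proof -
    \<comment> \<open>\<open>\<phi> h A\<close> is the objective after a step with batch
      \<open>A\<close> from the state that history \<open>h\<close> determines;
      \<open>\<psi> h\<close> is the bound on its average over the batch.\<close>
    define \<phi> where
      "\<phi> h A = F (W k h - \<alpha> *\<^sub>R (HH k h *v gradient (subset_avg f A) (W k h)))" for h A
    define \<psi> where "\<psi> h = F (W k h) - \<alpha> * \<mu>1 / 2 * (norm (gradient F (W k h)))\<^sup>2 + D" for h
    have "F (w (Suc k) \<omega>) = \<phi> (hist k \<omega>) (S k \<omega>)" for \<omega>
      unfolding \<phi>_def wW[symmetric] HHH[symmetric] unfolding w H by (simp only: lbfgs_w_Suc)
    then have "(\<integral>\<omega>. F (w (Suc k) \<omega>) \<partial>M) = (\<integral>\<omega>. \<phi> (hist k \<omega>) (S k \<omega>) \<partial>M)"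
      by simp
    also have "\<dots> \<le> (\<integral>\<omega>. \<psi> (hist k \<omega>) \<partial>M)"
    proof (rule integral_indep_mono[OF ind finS finhist])
      fix \<omega>' assume "\<omega>' \<in> space M"
      then have "mat \<mu>1 \<preceq> HH k (hist k \<omega>')" "HH k (hist k \<omega>') \<preceq> mat \<mu>2"
        using H_bounds[of \<omega>' k] by (auto simp: HHH)
      \<comment> \<open>With the history fixed at \<open>\<omega>'\<close> the iterate no longer
        varies with \<open>\<omega>\<close>, so \<open>unbiased\<close> and
        \<open>second_moment\<close>, which are stated at fixed points, apply to it.\<close>
      then show "(\<integral>\<omega>. \<phi> (hist k \<omega>') (S k \<omega>) \<partial>M) \<le> \<psi> (hist k \<omega>')"
        unfolding \<phi>_def \<psi>_def D_def
        by (intro expected_descent[OF Ssimple lip_F unbiased second_moment _ _ mu \<alpha>])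
    qed
    also have "\<dots> = (\<integral>\<omega>. F (w k \<omega>) \<partial>M)
        - \<alpha> * \<mu>1 / 2 * (\<integral>\<omega>. (norm (gradient F (w k \<omega>)))\<^sup>2 \<partial>M) + D"
      unfolding \<psi>_def wW[symmetric]
      using int[of F k] int[of "\<lambda>x. (norm (gradient F x))\<^sup>2" k] by (simp add: prob_space)
    finally show ?thesis .
  qed
  have telescope: "\<alpha> * \<mu>1 / 2 * (\<Sum>k<L. \<integral>\<omega>. (norm (gradient F (w k \<omega>)))\<^sup>2 \<partial>M)
      \<le> F w0 - (\<integral>\<omega>. F (w L \<omega>) \<partial>M) + real L * D" for L
  proof (induction L)
    case 0
    then show ?case by (simp add: w lbfgs_w_def prob_space)
  next
    case (Suc L)
    then show ?case using step[of L] by (simp add: algebra_simps)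
  qed
  have bound: "(\<integral>\<omega>. (1 / real L) * (\<Sum>k<L. (norm (gradient F (w k \<omega>)))\<^sup>2) \<partial>M)
      \<le> \<alpha> * \<mu>2\<^sup>2 * \<gamma>\<^sup>2 * \<Lambda> / \<mu>1 + 2 * (F w0 - Fhat) / (\<alpha> * \<mu>1 * real L)" if "L \<ge> 1" for L
  proof -
    let ?E = "\<Sum>k<L. \<integral>\<omega>. (norm (gradient F (w k \<omega>)))\<^sup>2 \<partial>M"
    \<comment> \<open>The lower bound on \<open>F\<close> removes the last iterate from the
      telescoped sum.\<close>
    have "(\<integral>\<omega>. Fhat \<partial>M) \<le> (\<integral>\<omega>. F (w L \<omega>) \<partial>M)"
      by (rule integral_mono[OF _ int bounded_below]) simp
    then have "\<alpha> * \<mu>1 / 2 * ?E \<le> F w0 - Fhat + real L * D"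
      using telescope[of L] by (simp add: prob_space)
    \<comment> \<open>This factor turns the weighted sum into the average. It also turns the
      accumulated noise \<open>real L * D\<close> into the first term of the bound, where
      \<open>L\<close> cancels because \<open>L \<ge> 1\<close>.\<close>
    then have "(2 / (\<alpha> * \<mu>1 * real L)) * (\<alpha> * \<mu>1 / 2 * ?E)
        \<le> (2 / (\<alpha> * \<mu>1 * real L)) * (F w0 - Fhat + real L * D)"
      using \<alpha> mu by (intro mult_left_mono) auto
    moreover have "(2 / (\<alpha> * \<mu>1 * real L)) * (\<alpha> * \<mu>1 / 2 * ?E) = 1 / real L * ?E"
      using \<alpha> mu by simp
    moreover have "(2 / (\<alpha> * \<mu>1 * real L)) * (F w0 - Fhat + real L * D)
        = \<alpha> * \<mu>2\<^sup>2 * \<gamma>\<^sup>2 * \<Lambda> / \<mu>1 + 2 * (F w0 - Fhat) / (\<alpha> * \<mu>1 * real L)"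
      using \<alpha> mu that by (simp add: D_def power2_eq_square field_simps)
    moreover have "(\<integral>\<omega>. (1 / real L) * (\<Sum>k<L. (norm (gradient F (w k \<omega>)))\<^sup>2) \<partial>M)
        = 1 / real L * ?E"
      using int[of "\<lambda>x. (norm (gradient F x))\<^sup>2"] by simp
    ultimately show ?thesis by linarith
  qed
  have "(\<lambda>L. 2 * (F w0 - Fhat) / (\<alpha> * \<mu>1) / real L) \<longlonglongrightarrow> 0"
    by (rule lim_const_over_n)
  then have "(\<lambda>L. \<alpha> * \<mu>2\<^sup>2 * \<gamma>\<^sup>2 * \<Lambda> / \<mu>1 + 2 * (F w0 - Fhat) / (\<alpha> * \<mu>1) / real L)
      \<longlonglongrightarrow> \<alpha> * \<mu>2\<^sup>2 * \<gamma>\<^sup>2 * \<Lambda> / \<mu>1 + 0"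
    by (rule tendsto_add[OF tendsto_const])
  then have "(\<lambda>L. \<alpha> * \<mu>2\<^sup>2 * \<gamma>\<^sup>2 * \<Lambda> / \<mu>1 + 2 * (F w0 - Fhat) / (\<alpha> * \<mu>1 * real L))
      \<longlonglongrightarrow> \<alpha> * \<mu>2\<^sup>2 * \<gamma>\<^sup>2 * \<Lambda> / \<mu>1"
    by simp
  with bound show ?thesis
    by blast
qed

end
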